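(* There exists an absolute constant $C>0$ such that for every $n$, every (nonempty) set $F$ in $\mathbb{R}^n$ and every $\alpha\ge2$, $$N(F,\mathrm{Tower}^\alpha)\le\Sigma(CF)^\alpha .$$
   Context: $N(A,B)$ is the covering number: the minimal number of translates of $B$ (by vectors of $\mathbb{R}^n$) whose union contains $A$. **Tower.** For $\alpha\ge2$ let $\theta_\alpha(t)=e^{\alpha^t-\alpha}$ for $t\ge1$ and $\theta_\alpha(t)=t$ for $0\le t<1$. For $x\in\mathbb{R}^n$ let $\|x\|_{\mathrm{Tower}^\alpha}$ be the infimum of $\lambda>0$ such that $\frac1n|\{i:|x(i)|/\lambda\ge t\}|\le1/\theta_\alpha(t)$ for all $t>0$. Then $\mathrm{Tower}^\alpha=\{x\in\mathbb{R}^n:\|x\|_{\mathrm{Tower}^\alpha}\le1\}$. **Cell content.** An octant in $\mathbb{R}^k$ is a translate of a set of all points with fixed and nonzero signs of the coordinates. The coordinate convex hull $\mathrm{cconv}(A)$ of a set $A\subseteq\mathbb{R}^k$ is what remains of $\mathbb{R}^k$ after removing all octants disjoint from $A$. For nonempty $A\subseteq\mathbb{R}^n$, $$\Sigma(A)=\sum_P\ (\text{number of integer cells contained in }\mathrm{cconv}(PA)),$$ the sum being over all $2^n$ coordinate projections $P$ (orthogonal projections of $\mathbb{R}^n$ onto $\mathbb{R}^\sigma$, $\sigma\subseteq\{1,\dots,n\}$), with $\mathrm{cconv}(PA)$ taken in $\mathbb{R}^\sigma$; the integer cells in $\mathbb{R}^\sigma$ are the sets $a+[0,1]^\sigma$,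 $a\in\mathbb{Z}^\sigma$; the summand for the $0$-dimensional projection is set to be $1$. ($\Sigma(A)$ may be infinite.) *)

theory Defs
  imports "HOL-Analysis.Analysis"
begin

text \<open>
  For a finite index set \<open>I\<close> of natural numbers, \<open>\<real>\<^sup>I\<close> is represented by the functions
  \<open>nat \<Rightarrow> real\<close> that are extensional on \<open>I\<close> (so that equality of points is equality of functions),
  and \<open>\<real>\<^sup>n\<close> is the case \<open>I = {1..n}\<close>. A type-indexed dimension would not allow a constant that is
  uniform in \<open>n\<close>, nor projections onto arbitrary coordinate subspaces.
\<close>

definition rspace :: "nat set \<Rightarrow> (nat \<Rightarrow> real) set" where
  "rspace I = (I \<rightarrow>\<^sub>E UNIV)"

definition translate_by :: "nat set \<Rightarrow> (nat \<Rightarrow> real) \<Rightarrow> (nat \<Rightarrow> real) set \<Rightarrow> (nat \<Rightarrow> real) set" where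
  "translate_by I v B = (\<lambda>x. \<lambda>i\<in>I. v i + x i) ` B"

definition dilate :: "nat set \<Rightarrow> real \<Rightarrow> (nat \<Rightarrow> real) set \<Rightarrow> (nat \<Rightarrow> real) set" where
  "dilate I c A = (\<lambda>x. \<lambda>i\<in>I. c * x i) ` A"

definition coord_proj :: "nat set \<Rightarrow> (nat \<Rightarrow> real) set \<Rightarrow> (nat \<Rightarrow> real) set" where
  "coord_proj \<sigma> A = (\<lambda>x. restrict x \<sigma>) ` A"

text \<open>Cardinality with value \<open>\<infinity>\<close> on infinite sets, where \<^const>\<open>card\<close> would be \<open>0\<close>.\<close>

definition ecard :: "'a set \<Rightarrow> enat" where
  "ecard A = (if finite A then enat (card A) else \<infinity>)"

text \<open>Infinite covering families are allowed, with cardinality \<open>\<infinity>\<close>.\<close>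

definition covering_number ::
  "nat set \<Rightarrow> (nat \<Rightarrow> real) set \<Rightarrow> (nat \<Rightarrow> real) set \<Rightarrow> enat" where
  "covering_number I A B =
     (INF \<T> \<in> {\<T>. \<T> \<subseteq> (\<lambda>v. translate_by I v B) ` rspace I \<and> A \<subseteq> \<Union>\<T>}. ecard \<T>)"

text \<open>Only the values at \<open>t \<ge> 0\<close> matter.\<close>

definition tower_theta :: "real \<Rightarrow> real \<Rightarrow> real" where
  "tower_theta \<alpha> t = (if t \<ge> 1 then exp (\<alpha> powr t - \<alpha>) else t)"

definition tower_norm :: "real \<Rightarrow> nat \<Rightarrow> (nat \<Rightarrow> real) \<Rightarrow> real" where
  "tower_norm \<alpha> n x =
     Inf {l. l > 0 \<and>
       (\<forall>t>0. (1 / real n) * real (card {i \<in> {1..n}. \<bar>x i\<bar> / l \<ge> t}) \<le> 1 / tower_theta \<alpha> t)}"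

definition Tower :: "real \<Rightarrow> nat \<Rightarrow> (nat \<Rightarrow> real) set" where
  "Tower \<alpha> n = {x \<in> rspace {1..n}. tower_norm \<alpha> n x \<le> 1}"

definition octant :: "nat set \<Rightarrow> (nat \<Rightarrow> real) set \<Rightarrow> bool" where
  "octant I Q \<longleftrightarrow> (\<exists>v \<in> rspace I. \<exists>s \<in> I \<rightarrow> {-1, 1}.
     Q = translate_by I v {x \<in> rspace I. \<forall>i\<in>I. sgn (x i) = s i})"

definition cconv :: "nat set \<Rightarrow> (nat \<Rightarrow> real) set \<Rightarrow> (nat \<Rightarrow> real) set" where
  "cconv I A = rspace I - \<Union>{Q. octant I Q \<and> Q \<inter> A = {}}"

definition integer_cell :: "nat set \<Rightarrow> (nat \<Rightarrow> real) set \<Rightarrow> bool" where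
  "integer_cell I Q \<longleftrightarrow> (\<exists>a \<in> I \<rightarrow>\<^sub>E \<int>. Q = translate_by I a (I \<rightarrow>\<^sub>E {0..1}))"

definition cell_content :: "nat \<Rightarrow> (nat \<Rightarrow> real) set \<Rightarrow> enat" where
  "cell_content n A =
     (\<Sum>\<sigma> \<in> Pow {1..n}.
        if \<sigma> = {} then 1
        else ecard {Q. integer_cell \<sigma> Q \<and> Q \<subseteq> cconv \<sigma> (coord_proj \<sigma> A)})"

text \<open>Real powers of extended naturals, for positive exponents.\<close>

definition enat_powr :: "enat \<Rightarrow> real \<Rightarrow> ereal" where
  "enat_powr m a = (case m of enat k \<Rightarrow> ereal (real k powr a) | \<infinity> \<Rightarrow> \<infinity>)"

end

theory Submission
  imports Defs
begin

text \<open>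
  The constant is \<open>C = 10\<close>. Call two points of \<open>\<real>\<^sup>n\<close> far apart at the level \<open>\<lambda>\<close> if their difference fails
  the tail condition of the tower norm for this \<open>\<lambda>\<close>, as it does when its norm exceeds \<open>\<lambda>\<close>. A maximal set \<open>S\<close> of points of \<open>F\<close> that are pairwise far apart at the level \<open>1\<close>
  is the set of centres of a covering of \<open>F\<close> by translates of the tower, so it suffices to show
  \<open>card A powr (1/\<alpha>) \<le> \<Sigma>(A)\<close> for the finite set \<open>A = 10 S\<close>, whose points are pairwise far apart at the
  level \<open>10\<close>. This goes by induction on the size of \<open>A\<close>, and rests on two facts.

  First, the cell content is superadditive under a split of a set along a slab (lemma
  \<open>card_hull_cells_superadditive\<close>). If \<open>L\<close> lies in \<open>x i \<le> a\<close> and \<open>U\<close> in \<open>x i \<ge> a + 1\<close>, where \<open>a\<close> is an integer,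
  then a cell \<open>Q\<close> that is counted both for \<open>L\<close> and for \<open>U\<close> does not involve the coordinate \<open>i\<close>, and
  the cell \<open>Q \<times> [a, a + 1]\<close>, of one dimension more, is counted for \<open>L \<union> U\<close> but for neither part.

  Secondly, a finite set \<open>A\<close> of at least two points, pairwise far apart at the level \<open>10\<close>, has a coordinate and an integer slab
  such that the two parts of \<open>A\<close> on its sides are nonempty and satisfy
  \<open>card L powr (1/\<alpha>) + card U powr (1/\<alpha>) \<ge> card A powr (1/\<alpha>)\<close>. Otherwise, let \<open>f\<close> be a random point of \<open>A\<close>
  and \<open>M\<close> an integer close to a median of \<open>f i\<close>. The failure of the inequality at every slab forces
  each tail probability to be at most the power \<open>\<alpha>\<close> of a fraction of the one a unit step closer to \<open>M\<close>,
  provided that the latter is at most \<open>1/2\<close>; so the tails decay like \<open>exp (- (\<alpha> ^ k))\<close> (lemma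
  \<open>tower_tail_unsplit\<close>). By Markov's inequality most points of \<open>A\<close> are then so close to \<open>M\<close> in the tower
  norm that two of them are not far apart (lemma \<open>exists_not_tower_far\<close>), a contradiction.

  The induction step applies the induction hypothesis to the two parts and adds up the results.
\<close>

section \<open>Cells and the coordinate convex hull\<close>

lemma translate_by_eq:
  assumes "B \<subseteq> rspace I" "v \<in> rspace I"
  shows "translate_by I v B = {x \<in> rspace I. (\<lambda>i\<in>I. x i - v i) \<in> B}"
proof (intro equalityI subsetI)
  fix x assume "x \<in> translate_by I v B"
  then obtain y where y: "y \<in> B" "x = (\<lambda>i\<in>I. v i + y i)"
    by (auto simp: translate_by_def)
  have "y \<in> extensional I" using y(1) assms(1) by (auto simp: rspace_def PiE_def)
  then have "(\<lambda>i\<in>I. x i - v i) = y"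
    using y(2) by (auto simp: fun_eq_iff extensional_def)
  then show "x \<in> {x \<in> rspace I. (\<lambda>i\<in>I. x i - v i) \<in> B}"
    using y by (auto simp: rspace_def)
next
  fix x assume x: "x \<in> {x \<in> rspace I. (\<lambda>i\<in>I. x i - v i) \<in> B}"
  then have "x = (\<lambda>i\<in>I. v i + (\<lambda>i\<in>I. x i - v i) i)"
    by (auto simp: fun_eq_iff rspace_def PiE_def extensional_def)
  then show "x \<in> translate_by I v B"
    using x unfolding translate_by_def by blast
qed

lemma mem_cconv_iff:
  "x \<in> cconv I A \<longleftrightarrow> x \<in> rspace I \<and>
     (\<forall>v\<in>rspace I. \<forall>s\<in>I \<rightarrow> {-1, 1}. (\<forall>i\<in>I. sgn (x i - v i) = s i) \<longrightarrow>
        (\<exists>y\<in>A. y \<in> rspace I \<and> (\<forall>i\<in>I. sgn (y i - v i) = s i)))"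
proof -
  have *: "translate_by I v {x \<in> rspace I. \<forall>i\<in>I. sgn (x i) = s i} =
      {x \<in> rspace I. \<forall>i\<in>I. sgn (x i - v i) = s i}" if "v \<in> rspace I" for v s
    using that by (subst translate_by_eq) (auto simp: rspace_def)
  have octant_iff: "octant I Q \<longleftrightarrow> (\<exists>v\<in>rspace I. \<exists>s\<in>I \<rightarrow> {-1, 1}.
      Q = {x \<in> rspace I. \<forall>i\<in>I. sgn (x i - v i) = s i})" for Q
    unfolding octant_def using * by (simp cong: bex_cong)
  have "x \<in> cconv I A \<longleftrightarrow> x \<in> rspace I \<and> (\<forall>Q. octant I Q \<longrightarrow> x \<in> Q \<longrightarrow> Q \<inter> A \<noteq> {})"
    unfolding cconv_def by blast
  also have "\<dots> \<longleftrightarrow> x \<in> rspace I \<and>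
     (\<forall>v\<in>rspace I. \<forall>s\<in>I \<rightarrow> {-1, 1}. x \<in> {x \<in> rspace I. \<forall>i\<in>I. sgn (x i - v i) = s i} \<longrightarrow>
        {x \<in> rspace I. \<forall>i\<in>I. sgn (x i - v i) = s i} \<inter> A \<noteq> {})"
    unfolding octant_iff by blast
  also have "\<dots> \<longleftrightarrow> x \<in> rspace I \<and>
     (\<forall>v\<in>rspace I. \<forall>s\<in>I \<rightarrow> {-1, 1}. (\<forall>i\<in>I. sgn (x i - v i) = s i) \<longrightarrow>
        (\<exists>y\<in>A. y \<in> rspace I \<and> (\<forall>i\<in>I. sgn (y i - v i) = s i)))"
    by (intro conj_cong refl ball_cong imp_cong) blast+
  finally show ?thesis .
qed

lemma integer_cell_iff:
  "integer_cell I Q \<longleftrightarrow> (\<exists>a \<in> I \<rightarrow>\<^sub>E \<int>. Q = (\<Pi>\<^sub>E i\<in>I. {a i..a i + 1}))"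
proof -
  have "translate_by I a (I \<rightarrow>\<^sub>E {0..1}) = (\<Pi>\<^sub>E i\<in>I. {a i..a i + 1})" if "a \<in> I \<rightarrow>\<^sub>E \<int>" for a
  proof -
    have "I \<rightarrow>\<^sub>E {0..1} \<subseteq> rspace I" "a \<in> rspace I" using that by (auto simp: rspace_def PiE_def)
    then have "translate_by I a (I \<rightarrow>\<^sub>E {0..1}) = {x \<in> rspace I. \<forall>i\<in>I. 0 \<le> x i - a i \<and> x i - a i \<le> 1}"
      by (subst translate_by_eq) (auto simp: PiE_iff)
    also have "\<dots> = (\<Pi>\<^sub>E i\<in>I. {a i..a i + 1})"
      unfolding rspace_def by (auto simp: PiE_def Pi_iff algebra_simps)
    finally show ?thesis .
  qed
  then show ?thesis unfolding integer_cell_def by auto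
qed

lemma cconv_mono: "A \<subseteq> B \<Longrightarrow> cconv I A \<subseteq> cconv I B"
  unfolding cconv_def by blast

text \<open>
  A point strictly beyond the hyperplane that bounds the half-space lies in an octant which is
  contained in the complementary half-space and therefore misses \<open>A\<close>.
\<close>
lemma cconv_halfspace:
  assumes "x \<in> cconv I A" "i \<in> I"
  shows "(\<And>y. y \<in> A \<Longrightarrow> y i \<le> a) \<Longrightarrow> x i \<le> a" and "(\<And>y. y \<in> A \<Longrightarrow> a \<le> y i) \<Longrightarrow> a \<le> x i"
proof -
  have x: "x \<in> rspace I" using assms by (simp add: mem_cconv_iff)
  \<comment> \<open>An octant containing \<open>x\<close> whose face orthogonal to the direction \<open>i\<close> is at the level \<open>a\<close>.\<close>
  define v where "v = (\<lambda>j\<in>I. if j = i then a else x j - 1)"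
  have meet: "\<exists>y\<in>A. sgn (y i - a) = sgn (x i - a)" if "x i \<noteq> a"
  proof -
    define s where "s j = sgn (x j - v j)" for j
    have "v \<in> rspace I" "s \<in> I \<rightarrow> {-1, 1}" "\<forall>j\<in>I. sgn (x j - v j) = s j"
      using that by (auto simp: v_def rspace_def s_def sgn_if)
    then obtain y where "y \<in> A" "\<forall>j\<in>I. sgn (y j - v j) = s j"
      using assms(1) unfolding mem_cconv_iff by blast
    then have "sgn (y i - v i) = sgn (x i - v i)" using assms(2) by (simp add: s_def)
    then show ?thesis using \<open>y \<in> A\<close> assms(2) by (auto simp: v_def)
  qed
  show "x i \<le> a" if "\<And>y. y \<in> A \<Longrightarrow> y i \<le> a"
  proof (rule ccontr)
    assume "\<not> x i \<le> a"
    with meet obtain y where "y \<in> A" "sgn (y i - a) = 1" by (auto simp: sgn_if)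
    with that[of y] show False by (auto simp: sgn_if split: if_splits)
  qed
  show "a \<le> x i" if "\<And>y. y \<in> A \<Longrightarrow> a \<le> y i"
  proof (rule ccontr)
    assume "\<not> a \<le> x i"
    with meet obtain y where "y \<in> A" "sgn (y i - a) = -1" by (auto simp: sgn_if)
    with that[of y] show False by (auto simp: sgn_if split: if_splits)
  qed
qed

text \<open>
  An octant that contains \<open>x\<close> is unbounded in one of the two directions of the coordinate \<open>i\<close>, and in
  that direction it contains the whole of the range of \<open>y i\<close> for \<open>y\<close> in \<open>U\<close> or in \<open>L\<close>, respectively. In the
  remaining coordinates it meets the projections of both sets.
\<close>
lemma cconv_coord_proj_insert:
  assumes x: "x \<in> rspace (insert i \<sigma>)" "a \<le> x i" "x i \<le> b"
    and lo: "restrict x \<sigma> \<in> cconv \<sigma> (coord_proj \<sigma> L)" "\<And>y. y \<in> L \<Longrightarrow> y i \<le> a"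
    and hi: "restrict x \<sigma> \<in> cconv \<sigma> (coord_proj \<sigma> U)" "\<And>y. y \<in> U \<Longrightarrow> b \<le> y i"
    and "i \<notin> \<sigma>"
  shows "x \<in> cconv (insert i \<sigma>) (coord_proj (insert i \<sigma>) (L \<union> U))"
  unfolding mem_cconv_iff
proof (intro conjI ballI impI)
  show "x \<in> rspace (insert i \<sigma>)" by fact
  fix v s assume v: "v \<in> rspace (insert i \<sigma>)" and s: "s \<in> insert i \<sigma> \<rightarrow> {-1, 1}"
    and xs: "\<forall>j\<in>insert i \<sigma>. sgn (x j - v j) = s j"
  define H where "H = (if s i = 1 then U else L)"
  have "restrict x \<sigma> \<in> cconv \<sigma> (coord_proj \<sigma> H)" using lo hi by (simp add: H_def)
  moreover have "restrict v \<sigma> \<in> rspace \<sigma>" "s \<in> \<sigma> \<rightarrow> {-1, 1}"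
    "\<forall>j\<in>\<sigma>. sgn (restrict x \<sigma> j - restrict v \<sigma> j) = s j"
    using s xs by (auto simp: rspace_def)
  ultimately obtain z where "z \<in> coord_proj \<sigma> H" "\<forall>j\<in>\<sigma>. sgn (z j - restrict v \<sigma> j) = s j"
    unfolding mem_cconv_iff by blast
  then obtain y where y: "y \<in> H" "\<forall>j\<in>\<sigma>. sgn (y j - v j) = s j"
    by (auto simp: coord_proj_def)
  have "sgn (x i - v i) = s i" "s i = 1 \<or> s i = -1" using xs s by auto
  then have "sgn (y i - v i) = s i"
    using y(1) x(2,3) lo(2)[of y] hi(2)[of y]
    by (auto simp: H_def sgn_if split: if_splits)
  then show "\<exists>z\<in>coord_proj (insert i \<sigma>) (L \<union> U). z \<in> rspace (insert i \<sigma>) \<and>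
      (\<forall>j\<in>insert i \<sigma>. sgn (z j - v j) = s j)"
    using y by (intro bexI[of _ "restrict y (insert i \<sigma>)"])
      (auto simp: rspace_def coord_proj_def H_def split: if_splits)
qed

section \<open>Superadditivity of the cell content\<close>

text \<open>
  The cells counted by the cell content, tagged with the coordinates they live in, as one set: this
  turns inequalities between cell contents into statements about unions and injections. The empty
  set of coordinates needs no special treatment, since a nonempty \<open>A\<close> has exactly one cell there.
\<close>
definition hull_cells :: "nat \<Rightarrow> (nat \<Rightarrow> real) set \<Rightarrow> (nat set \<times> (nat \<Rightarrow> real) set) set" where
  "hull_cells n A = (SIGMA \<sigma>:Pow {1..n}. {Q. integer_cell \<sigma> Q \<and> Q \<subseteq> cconv \<sigma> (coord_proj \<sigma> A)})"

lemma hull_cells_mono: "A \<subseteq> B \<Longrightarrow> hull_cells n A \<subseteq> hull_cells n B"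
  using cconv_mono[OF image_mono] unfolding hull_cells_def coord_proj_def by blast

lemma hull_cells_empty_dim:
  assumes "A \<noteq> {}"
  shows "{Q. integer_cell {} Q \<and> Q \<subseteq> cconv {} (coord_proj {} A)} = {{\<lambda>_. undefined}}"
proof -
  have "coord_proj {} A = {\<lambda>_. undefined}"
    using assms by (auto simp: coord_proj_def restrict_def)
  then show ?thesis by (auto simp: integer_cell_iff mem_cconv_iff rspace_def)
qed

lemma ecard_SIGMA:
  assumes "finite I"
  shows "(\<Sum>i\<in>I. ecard (B i)) = ecard (Sigma I B)"
proof (cases "\<forall>i\<in>I. finite (B i)")
  case True
  then have "(\<Sum>i\<in>I. ecard (B i)) = (\<Sum>i\<in>I. enat (card (B i)))"
    by (simp add: ecard_def)
  also have "\<dots> = enat (\<Sum>i\<in>I. card (B i))" 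
    using assms by (induction I rule: finite_induct) (auto simp: zero_enat_def)
  finally show ?thesis using True assms by (simp add: ecard_def)
next
  case False
  then obtain i where i: "i \<in> I" "infinite (B i)" by auto
  have "B i \<subseteq> snd ` Sigma I B" using i(1) by force
  then have "infinite (Sigma I B)"
    using i(2) finite_surj by blast
  moreover have "(\<Sum>i\<in>I. ecard (B i)) = \<infinity>"
    using i assms by (simp add: sum.remove ecard_def)
  ultimately show ?thesis by (simp add: ecard_def)
qed

lemma cell_content_eq_ecard:
  assumes "A \<noteq> {}"
  shows "cell_content n A = ecard (hull_cells n A)"
proof -
  have "cell_content n A = 
    (\<Sum>\<sigma>\<in>Pow {1..n}. ecard {Q. integer_cell \<sigma> Q \<and> Q \<subseteq> cconv \<sigma> (coord_proj \<sigma> A)})"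
    unfolding cell_content_def
    by (intro sum.cong refl) (auto simp: hull_cells_empty_dim[OF assms] ecard_def one_enat_def)
  then show ?thesis by (simp add: ecard_SIGMA hull_cells_def)
qed

text \<open>
  The cells counted for both parts are compensated by new cells: such a cell \<open>Q\<close> lives in coordinates
  other than \<open>i\<close>, because its \<open>i\<close>-th coordinates would have to be at most \<open>a\<close> and at least \<open>a + 1\<close>.
  The assignment \<open>Q \<mapsto> Q \<times> [a, a + 1]\<close> is injective, and its values are cells of the hull of the union
  that reach both \<open>a\<close> and \<open>a + 1\<close> in the direction \<open>i\<close>, so they belong to neither part.
\<close>
lemma card_hull_cells_superadditive:
  assumes lo: "\<And>y. y \<in> L \<Longrightarrow> y i \<le> a" and hi: "\<And>y. y \<in> U \<Longrightarrow> a + 1 \<le> y i"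
    and a: "a \<in> \<int>" and i: "i \<in> {1..n}" and fin: "finite (hull_cells n (L \<union> U))"
  shows "card (hull_cells n L) + card (hull_cells n U) \<le> card (hull_cells n (L \<union> U))"
proof -
  let ?A = "hull_cells n (L \<union> U)" and ?L = "hull_cells n L" and ?U = "hull_cells n U"
  have sub: "?L \<subseteq> ?A" "?U \<subseteq> ?A" by (intro hull_cells_mono; blast)+
  note finLU = finite_subset[OF sub(1) fin] finite_subset[OF sub(2) fin]
  define lift where "lift = (\<lambda>(\<sigma>, Q). 
    (insert i \<sigma>, {x \<in> rspace (insert i \<sigma>). restrict x \<sigma> \<in> Q \<and> a \<le> x i \<and> x i \<le> a + 1}))"
  have coord_lo: "x i \<le> a" if "x \<in> cconv \<sigma> (coord_proj \<sigma> L)" "i \<in> \<sigma>" for x \<sigma>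
    using that by (intro cconv_halfspace(1)[OF that]) (auto simp: coord_proj_def lo)
  have coord_hi: "a + 1 \<le> x i" if "x \<in> cconv \<sigma> (coord_proj \<sigma> U)" "i \<in> \<sigma>" for x \<sigma>
    using that by (intro cconv_halfspace(2)[OF that]) (auto simp: coord_proj_def hi)
  have ne: "Q \<noteq> {}" if "integer_cell \<sigma> Q" for \<sigma> Q
    using that by (auto simp: integer_cell_iff PiE_eq_empty_iff)
  have common: "i \<notin> \<sigma>" if LU: "(\<sigma>, Q) \<in> ?L \<inter> ?U" for \<sigma> Q
  proof
    assume "i \<in> \<sigma>"
    from LU ne[of \<sigma> Q] obtain x where "x \<in> Q" by (auto simp: hull_cells_def)
    then have "x \<in> cconv \<sigma> (coord_proj \<sigma> L)" "x \<in> cconv \<sigma> (coord_proj \<sigma> U)"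
      using LU by (auto simp: hull_cells_def)
    with coord_lo[of x \<sigma>] coord_hi[of x \<sigma>] \<open>i \<in> \<sigma>\<close> show False by simp
  qed
  have recover: "(\<lambda>x. restrict x \<sigma>) ` snd (lift (\<sigma>, Q)) = Q"
    if "(\<sigma>, Q) \<in> ?L \<inter> ?U" for \<sigma> Q
  proof (intro equalityI subsetI)
    fix z assume z: "z \<in> Q"
    have zr: "z \<in> rspace \<sigma>" using that z by (auto simp: hull_cells_def mem_cconv_iff)
    have "restrict (z(i := a)) \<sigma> = z"
      using zr common[OF that] by (auto simp: fun_eq_iff rspace_def PiE_def extensional_def)
    moreover have "z(i := a) \<in> snd (lift (\<sigma>, Q))"
      using zr z calculation by (auto simp: lift_def rspace_def PiE_def extensional_def)
    ultimately show "z \<in> (\<lambda>x. restrict x \<sigma>) ` snd (lift (\<sigma>, Q))" by (metis image_eqI)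
  qed (auto simp: lift_def)
  have inj: "inj_on lift (?L \<inter> ?U)"
  proof (rule inj_onI)
    fix p q assume pq: "p \<in> ?L \<inter> ?U" "q \<in> ?L \<inter> ?U" "lift p = lift q"
    obtain \<sigma> Q \<tau> R where p: "p = (\<sigma>, Q)" and q: "q = (\<tau>, R)" by fastforce
    have "insert i \<sigma> = insert i \<tau>" using pq(3) by (simp add: p q lift_def)
    then have "\<sigma> = \<tau>" using common[of \<sigma> Q] common[of \<tau> R] pq(1,2) p q by (metis insert_ident)
    moreover have "Q = R"
    proof -
      have "Q = (\<lambda>x. restrict x \<sigma>) ` snd (lift p)" using recover pq(1) unfolding p by metis
      also have "\<dots> = (\<lambda>x. restrict x \<tau>) ` snd (lift q)" using pq(3) \<open>\<sigma> = \<tau>\<close> by metis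
      also have "\<dots> = R" using recover pq(2) unfolding q by metis
      finally show ?thesis .
    qed
    ultimately show "p = q" using p q by simp
  qed
  have new: "lift p \<in> ?A - (?L \<union> ?U)" if p: "p \<in> ?L \<inter> ?U" for p
  proof -
    obtain \<sigma> Q where [simp]: "p = (\<sigma>, Q)" by fastforce
    let ?R = "{x \<in> rspace (insert i \<sigma>). restrict x \<sigma> \<in> Q \<and> a \<le> x i \<and> x i \<le> a + 1}"
    have i\<sigma>: "i \<notin> \<sigma>" using common p by simp
    have \<sigma>: "\<sigma> \<subseteq> {1..n}" "integer_cell \<sigma> Q" "Q \<subseteq> cconv \<sigma> (coord_proj \<sigma> L)"
        "Q \<subseteq> cconv \<sigma> (coord_proj \<sigma> U)"
      using p by (auto simp: hull_cells_def)
    obtain b where b: "b \<in> \<sigma> \<rightarrow>\<^sub>E \<int>" "Q = (\<Pi>\<^sub>E j\<in>\<sigma>. {b j..b j + 1})"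
      using \<sigma>(2) by (auto simp: integer_cell_iff)
    have "?R = (\<Pi>\<^sub>E j\<in>insert i \<sigma>. {(b(i := a)) j..(b(i := a)) j + 1})"
    proof -
      have ji: "j \<noteq> i" if "j \<in> \<sigma>" for j using that i\<sigma> by blast
      show ?thesis unfolding b(2) rspace_def PiE_def by (auto simp: Pi_iff ji)
    qed
    moreover have "b(i := a) \<in> insert i \<sigma> \<rightarrow>\<^sub>E \<int>"
      using b(1) a by (auto simp: PiE_iff extensional_def)
    ultimately have cell: "integer_cell (insert i \<sigma>) ?R"
      unfolding integer_cell_iff by blast
    have "?R \<subseteq> cconv (insert i \<sigma>) (coord_proj (insert i \<sigma>) (L \<union> U))"
      using \<sigma>(3,4) lo hi i\<sigma> by (auto intro!: cconv_coord_proj_insert[of _ i \<sigma> a "a + 1"])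
    then have "lift p \<in> ?A" using cell \<sigma>(1) i by (auto simp: lift_def hull_cells_def)
    moreover obtain z where z: "z \<in> Q" using ne[OF \<sigma>(2)] by blast
    have zr: "z \<in> rspace \<sigma>" using \<sigma>(3) z by (auto simp: mem_cconv_iff)
    have rz: "restrict (z(i := c)) \<sigma> = z" for c
      using zr i\<sigma> by (auto simp: fun_eq_iff rspace_def PiE_def extensional_def)
    have "z(i := c) \<in> rspace (insert i \<sigma>)" for c
      using zr by (auto simp: rspace_def PiE_def extensional_def)
    then have mem: "z(i := a) \<in> ?R" "z(i := a + 1) \<in> ?R" using z rz by auto
    have "lift p \<notin> ?L"
    proof
      assume "lift p \<in> ?L"
      then have "z(i := a + 1) \<in> cconv (insert i \<sigma>) (coord_proj (insert i \<sigma>) L)"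
        using mem unfolding lift_def hull_cells_def by auto
      from coord_lo[OF this] show False by simp
    qed
    moreover have "lift p \<notin> ?U"
    proof
      assume "lift p \<in> ?U"
      then have "z(i := a) \<in> cconv (insert i \<sigma>) (coord_proj (insert i \<sigma>) U)"
        using mem unfolding lift_def hull_cells_def by auto
      from coord_hi[OF this] show False by simp
    qed
    ultimately show ?thesis by simp
  qed
  have "card (?L \<inter> ?U) \<le> card (?A - (?L \<union> ?U))"
    by (rule card_inj_on_le[OF inj]) (use new fin in auto)
  moreover have "card (?A - (?L \<union> ?U)) = card ?A - card (?L \<union> ?U)"
    using sub finLU by (intro card_Diff_subset) auto
  moreover have "card (?L \<union> ?U) \<le> card ?A" using sub fin by (intro card_mono) auto
  moreover have "card ?L + card ?U = card (?L \<union> ?U) + card (?L \<inter> ?U)"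
    using finLU by (rule card_Un_Int)
  ultimately show ?thesis by linarith
qed

section \<open>Tower-type tails\<close>

text \<open>
  If \<open>q\<close> is the share of the points above a slab and \<open>1 - r\<close> the share below it, the last hypothesis
  says that the slab does not split the set well. It then forces \<open>q\<close> to be much smaller than \<open>r\<close>.
\<close>
lemma tail_step:
  fixes \<alpha> q r :: real
  assumes "\<alpha> \<ge> 2" "0 \<le> r" "r \<le> 1/2" "0 \<le> q"
    and "q powr (1/\<alpha>) \<le> 1 - (1 - r) powr (1/\<alpha>)"
  shows "q \<le> (3/5 * r) powr \<alpha>"
proof -
  \<comment> \<open>\<open>(1 - r) powr (1/\<alpha>) \<ge> sqrt (1 - r) \<ge> 1 - 3/5 * r\<close>, the second step because \<open>r \<le> 1/2\<close>.\<close>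
  have "(1 - 3/5 * r)\<^sup>2 \<le> 1 - r"
  proof -
    have "r * r \<le> r * (1/2)" using assms by (intro mult_left_mono) auto
    then show ?thesis using assms by (simp add: power2_eq_square algebra_simps)
  qed
  then have "1 - 3/5 * r \<le> sqrt (1 - r)" by (rule real_le_rsqrt)
  also have "\<dots> = (1 - r) powr (1/2)" using assms by (simp add: powr_half_sqrt)
  also have "\<dots> \<le> (1 - r) powr (1/\<alpha>)"
    using assms by (intro powr_mono') (auto simp: field_simps)
  finally have "q powr (1/\<alpha>) \<le> 3/5 * r" using assms by linarith
  then have "(q powr (1/\<alpha>)) powr \<alpha> \<le> (3/5 * r) powr \<alpha>"
    using assms by (intro powr_mono2) auto
  then show ?thesis using assms by (simp add: powr_powr)
qed

text \<open>
  The first step brings the tail down to \<open>exp (- \<alpha>)\<close>, because \<open>3/5 * 1/2 \<le> exp (- 1)\<close>; every later step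
  raises it at least to the power \<open>\<alpha>\<close>, that is, multiplies the exponent by \<open>\<alpha>\<close>.
\<close>
lemma tower_tail_of_recursion:
  fixes r :: "nat \<Rightarrow> real"
  assumes \<alpha>: "\<alpha> \<ge> 2" and r: "\<And>k. 0 \<le> r k" "\<And>k. r k \<le> 1/2"
    and step: "\<And>k. r (Suc k) powr (1/\<alpha>) \<le> 1 - (1 - r k) powr (1/\<alpha>)"
  shows "r (Suc k) \<le> exp (- (\<alpha> ^ Suc k))"
proof (induction k)
  case 0
  have "r (Suc 0) \<le> (3/5 * r 0) powr \<alpha>" using \<alpha> r step by (intro tail_step) auto
  also have "\<dots> \<le> exp (-1) powr \<alpha>"
  proof (rule powr_mono2)
    have "inverse (exp (1::real)) \<ge> inverse 3" by (rule le_imp_inverse_le[OF exp_le]) simp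
    then show "3/5 * r 0 \<le> exp (-1)" using r(2)[of 0] by (simp add: exp_minus)
  qed (use \<alpha> r in auto)
  finally show ?case by (simp add: powr_def)
next
  case (Suc k)
  have "r (Suc (Suc k)) \<le> (3/5 * r (Suc k)) powr \<alpha>" using \<alpha> r step by (intro tail_step) auto
  also have "\<dots> \<le> exp (- (\<alpha> ^ Suc k)) powr \<alpha>"
    using \<alpha> r(1)[of "Suc k"] Suc by (intro powr_mono2) auto
  finally show ?case by (simp add: powr_def)
qed

text \<open>
  No integer slab splits \<open>A\<close> along \<open>X\<close> into two nonempty parts whose sizes, raised to the power
  \<open>1/\<alpha>\<close>, sum up to at least that of \<open>A\<close>. Where this fails, there is a split for the main induction.
\<close>
definition unsplit :: "real \<Rightarrow> 'a set \<Rightarrow> ('a \<Rightarrow> real) \<Rightarrow> bool" where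
  "unsplit \<alpha> A X \<longleftrightarrow> (\<forall>a\<in>\<int>. {f\<in>A. X f \<le> a} \<noteq> {} \<longrightarrow> {f\<in>A. a + 1 \<le> X f} \<noteq> {} \<longrightarrow>
     card {f\<in>A. X f \<le> a} powr (1/\<alpha>) + card {f\<in>A. a + 1 \<le> X f} powr (1/\<alpha>) < card A powr (1/\<alpha>))"

text \<open>
  Reflection maps integer slabs to integer slabs, so lower tails can be treated as upper ones.
\<close>
lemma unsplit_uminus:
  assumes "unsplit \<alpha> A X"
  shows "unsplit \<alpha> A (\<lambda>f. - X f)"
  unfolding unsplit_def
proof (intro ballI impI)
  fix a :: real assume a: "a \<in> \<int>" and ne: "{f\<in>A. - X f \<le> a} \<noteq> {}" "{f\<in>A. a + 1 \<le> - X f} \<noteq> {}"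
  have eq: "{f\<in>A. - X f \<le> a} = {f\<in>A. (- a - 1) + 1 \<le> X f}" "{f\<in>A. a + 1 \<le> - X f} = {f\<in>A. X f \<le> - a - 1}"
    by auto
  have "- a - 1 \<in> \<int>" using a by auto
  then show "card {f\<in>A. - X f \<le> a} powr (1/\<alpha>) + card {f\<in>A. a + 1 \<le> - X f} powr (1/\<alpha>) < card A powr (1/\<alpha>)"
    using assms[unfolded unsplit_def, rule_format, of "- a - 1"] ne unfolding eq
    by (simp add: add.commute)
qed

text \<open>
  The tails \<open>r k\<close> at the integer levels \<open>b + k\<close> satisfy the recursion of
  \<open>tower_tail_of_recursion\<close>: apply \<open>unsplit\<close> to the slab between \<open>b + k\<close> and \<open>b + k + 1\<close>, whose lower
  part has the share \<open>1 - r k\<close>.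
\<close>
lemma upper_tail_unsplit:
  fixes X :: "'a \<Rightarrow> real" and b :: real
  assumes \<alpha>: "\<alpha> \<ge> 2" and A: "finite A" "A \<noteq> {}" and X: "unsplit \<alpha> A X" and b: "b \<in> \<int>"
    and half: "2 * card {f\<in>A. b < X f} \<le> card A"
  shows "card {f\<in>A. b + Suc k < X f} \<le> card A * exp (- (\<alpha> ^ Suc k))"
proof -
  define N where "N = real (card A)"
  have N: "N > 0" using A by (simp add: N_def card_gt_0_iff)
  define r where "r k = card {f\<in>A. b + real k < X f} / N" for k
  have r: "r k \<le> 1/2" for k
  proof -
    have "card {f\<in>A. b + real k < X f} \<le> card {f\<in>A. b < X f}" using A by (intro card_mono) auto
    then have "real (2 * card {f\<in>A. b + real k < X f}) \<le> N" using half N_def by linarith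
    then show ?thesis using N by (simp add: r_def field_simps)
  qed
  have step: "r (Suc k) powr (1/\<alpha>) \<le> 1 - (1 - r k) powr (1/\<alpha>)" for k
  proof (cases "{f\<in>A. b + real (Suc k) < X f} = {}")
    case True
    then have "r (Suc k) = 0" by (simp only: r_def) simp
    moreover have "(1 - r k) powr (1/\<alpha>) \<le> 1 powr (1/\<alpha>)"
      using r[of k] \<alpha> N by (intro powr_mono2) (auto simp: r_def)
    ultimately show ?thesis by simp
  next
    case False
    define a where "a = b + real k"
    have a: "a \<in> \<int>" using b by (simp add: a_def)
    let ?L = "{f\<in>A. X f \<le> a}" and ?U = "{f\<in>A. a + 1 \<le> X f}"
    have "?L = A - {f\<in>A. a < X f}" by auto
    then have "card ?L = card A - card {f\<in>A. a < X f}"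
      using A by (simp add: card_Diff_subset)
    moreover have "card {f\<in>A. a < X f} \<le> card A" using A by (intro card_mono) auto
    ultimately have "real (card ?L) = N - card {f\<in>A. a < X f}" by (simp add: N_def of_nat_diff)
    then have L: "card ?L = N * (1 - r k)" using N by (simp add: r_def a_def right_diff_distrib)
    then have "real (card ?L) \<noteq> 0" using N r[of k] by simp
    then have "?L \<noteq> {}" by (metis card.empty of_nat_0)
    have sub: "{f\<in>A. b + real (Suc k) < X f} \<subseteq> ?U" by (auto simp: a_def)
    then have "?U \<noteq> {}" using False by blast
    have "card {f\<in>A. b + real (Suc k) < X f} \<le> card ?U" using sub A by (intro card_mono) auto
    then have "N * r (Suc k) \<le> card ?U" using N by (simp only: r_def) simp
    then have "(N * r (Suc k)) powr (1/\<alpha>) \<le> card ?U powr (1/\<alpha>)"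
      using N \<alpha> by (intro powr_mono2) (auto simp: r_def)
    \<comment> \<open>The slab between \<open>a\<close> and \<open>a + 1\<close> is not a good split.\<close>
    also have "\<dots> \<le> N powr (1/\<alpha>) - card ?L powr (1/\<alpha>)"
      using X a \<open>?L \<noteq> {}\<close> \<open>?U \<noteq> {}\<close> unfolding unsplit_def N_def by fastforce
    finally have "(N * r (Suc k)) powr (1/\<alpha>) \<le> N powr (1/\<alpha>) - (N * (1 - r k)) powr (1/\<alpha>)"
      unfolding L .
    then have "N powr (1/\<alpha>) * r (Suc k) powr (1/\<alpha>) \<le> N powr (1/\<alpha>) * (1 - (1 - r k) powr (1/\<alpha>))"
      by (simp add: powr_mult right_diff_distrib[of "N powr _"])
    then show ?thesis using N by simp
  qed
  have "0 \<le> r k" for k using N by (simp add: r_def)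
  with \<alpha> have "r (Suc k) \<le> exp (- (\<alpha> ^ Suc k))"
    using r step by (rule tower_tail_of_recursion)
  then show ?thesis using N by (simp only: r_def N_def) (simp add: field_simps)
qed

text \<open>
  A median rounded down; the levels of the slabs are integers, so the centre has to be one too.
  The gap between \<open>M\<close> and \<open>M + 1\<close> absorbs the rounding.
\<close>
lemma integer_median:
  fixes X :: "'a \<Rightarrow> real"
  assumes A: "finite A"
  shows "\<exists>M\<in>\<int>. 2 * card {f\<in>A. X f < M} \<le> card A \<and> 2 * card {f\<in>A. M + 1 < X f} \<le> card A"
proof (cases "A = {}")
  case True
  then show ?thesis by (auto intro!: bexI[of _ 0])
next
  case False
  obtain l where l: "\<And>f. f \<in> A \<Longrightarrow> real_of_int l \<le> X f"
  proof
    fix f assume "f \<in> A"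
    then have "Min (X ` A) \<le> X f" using A by simp
    then show "real_of_int \<lfloor>Min (X ` A)\<rfloor> \<le> X f" by linarith
  qed
  obtain u :: nat where u: "\<And>f. f \<in> A \<Longrightarrow> X f < l + real u"
  proof -
    obtain u :: nat where "Max (X ` A) - l < real u" using reals_Archimedean2 by blast
    then have "X f < l + real u" if "f \<in> A" for f
    proof -
      have "X f \<le> Max (X ` A)" using A that by simp
      then show ?thesis using \<open>Max (X ` A) - l < real u\<close> by linarith
    qed
    then show ?thesis using that by blast
  qed
  let ?P = "\<lambda>k::nat. card A < 2 * card {f\<in>A. X f < l + real k}"
  have "{f\<in>A. X f < l + real u} = A" using u by auto
  then have "?P u" using A False by (simp add: card_gt_0_iff)
  moreover have "{f\<in>A. X f < real_of_int l} = {}" using l by force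
  then have "\<not> ?P 0" by (simp only: of_nat_0 add_0_right) simp
  ultimately obtain k where k: "\<not> ?P k" "?P (Suc k)"
    using nat_induct[of "\<lambda>k. \<not> ?P k" u] by blast
  let ?M = "l + real k"
  have "{f\<in>A. ?M + 1 < X f} \<subseteq> A - {f\<in>A. X f < l + real (Suc k)}" by auto
  then have "card {f\<in>A. ?M + 1 < X f} \<le> card (A - {f\<in>A. X f < l + real (Suc k)})"
    using A by (intro card_mono) auto
  also have "\<dots> = card A - card {f\<in>A. X f < l + real (Suc k)}"
    using A by (intro card_Diff_subset) auto
  finally have "2 * card {f\<in>A. ?M + 1 < X f} \<le> card A" using k(2) by linarith
  then show ?thesis using k(1) by (intro bexI[of _ ?M]) auto
qed

text \<open>
  The upper tails of \<open>X\<close> and of \<open>- X\<close>, started at \<open>M + 1\<close> and at \<open>- M\<close>.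
\<close>
lemma tower_tail_unsplit:
  fixes X :: "'a \<Rightarrow> real"
  assumes \<alpha>: "\<alpha> \<ge> 2" and A: "finite A" "A \<noteq> {}" and X: "unsplit \<alpha> A X"
  shows "\<exists>M. \<forall>k\<ge>1. card {f\<in>A. real k + 2 \<le> \<bar>X f - M\<bar>} \<le> 2 * card A * exp (- (\<alpha> ^ k))"
proof -
  obtain M where M: "M \<in> \<int>" "2 * card {f\<in>A. X f < M} \<le> card A" "2 * card {f\<in>A. M + 1 < X f} \<le> card A"
    using integer_median[OF A(1)] by blast
  have "card {f\<in>A. real k + 2 \<le> \<bar>X f - M\<bar>} \<le> 2 * card A * exp (- (\<alpha> ^ k))" if "k \<ge> 1" for k
  proof -
    obtain j where j: "k = Suc j" using \<open>k \<ge> 1\<close> by (cases k) auto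
    let ?U = "{f\<in>A. (M + 1) + real k < X f}" and ?L = "{f\<in>A. - M + real k < - X f}"
    have U: "card ?U \<le> card A * exp (- (\<alpha> ^ k))"
      unfolding j using M by (intro upper_tail_unsplit[OF \<alpha> A X]) auto
    have "{f\<in>A. - M < - X f} = {f\<in>A. X f < M}" by auto
    then have L: "card ?L \<le> card A * exp (- (\<alpha> ^ k))"
      unfolding j using M by (intro upper_tail_unsplit[OF \<alpha> A unsplit_uminus[OF X]]) auto
    have "card {f\<in>A. real k + 2 \<le> \<bar>X f - M\<bar>} \<le> card (?U \<union> ?L)"
      using A by (intro card_mono) (auto simp: abs_if split: if_splits)
    also have "\<dots> \<le> card ?U + card ?L" by (rule card_Un_le)
    finally show ?thesis using U L by linarith
  qed
  then show ?thesis by (intro exI[of _ M] allI impI)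
qed

section \<open>Separation in the tower norm\<close>

text \<open>
  \<open>x - y\<close> violates at some \<open>t\<close> the tail condition in the tower norm for \<open>\<lambda> = c\<close>. Only \<open>t \<ge> 1\<close> matters,
  since for smaller \<open>t\<close> the bound \<open>1 / \<theta>(t)\<close> exceeds \<open>1\<close>.
\<close>
definition tower_far :: "real \<Rightarrow> nat \<Rightarrow> real \<Rightarrow> (nat \<Rightarrow> real) \<Rightarrow> (nat \<Rightarrow> real) \<Rightarrow> bool" where
  "tower_far \<alpha> n c x y \<longleftrightarrow>
     (\<exists>t\<ge>1. real n * exp (\<alpha> - \<alpha> powr t) < card {i\<in>{1..n}. c * t \<le> \<bar>x i - y i\<bar>})"

text \<open>
  A norm above \<open>1\<close> means in particular that \<open>\<lambda> = 1\<close> is not admissible in the infimum.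
\<close>
lemma tower_far_of_tower_norm:
  assumes n: "n \<ge> 1" and norm: "1 < tower_norm \<alpha> n x"
  shows "\<exists>t\<ge>1. real n * exp (\<alpha> - \<alpha> powr t) < card {i\<in>{1..n}. t \<le> \<bar>x i\<bar>}"
proof -
  let ?S = "{l. l > 0 \<and>
       (\<forall>t>0. (1 / real n) * real (card {i \<in> {1..n}. \<bar>x i\<bar> / l \<ge> t}) \<le> 1 / tower_theta \<alpha> t)}"
  have "1 \<notin> ?S"
  proof
    assume "1 \<in> ?S"
    moreover have "bdd_below ?S" by (rule bdd_belowI[of _ 0]) auto
    ultimately have "Inf ?S \<le> 1" by (rule cInf_lower)
    with norm show False by (simp add: tower_norm_def)
  qed
  then obtain t where t: "t > 0"
    "1 / tower_theta \<alpha> t < (1 / real n) * card {i\<in>{1..n}. t \<le> \<bar>x i\<bar>}"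
    by (auto simp: not_le)
  have "t \<ge> 1"
  proof (rule ccontr)
    assume "\<not> t \<ge> 1"
    then have "1 < 1 / tower_theta \<alpha> t" using t(1) by (simp add: tower_theta_def)
    moreover have "card {i\<in>{1..n}. t \<le> \<bar>x i\<bar>} \<le> card {1..n}" by (intro card_mono) auto
    then have "(1 / real n) * card {i\<in>{1..n}. t \<le> \<bar>x i\<bar>} \<le> 1" using n by simp
    ultimately show False using t(2) by linarith
  qed
  moreover from this have "1 / tower_theta \<alpha> t = exp (\<alpha> - \<alpha> powr t)"
    by (simp add: tower_theta_def exp_diff)
  then have "real n * exp (\<alpha> - \<alpha> powr t) < real n * ((1 / real n) * card {i\<in>{1..n}. t \<le> \<bar>x i\<bar>})"
    using t(2) n by (intro mult_strict_left_mono) auto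
  then have "real n * exp (\<alpha> - \<alpha> powr t) < card {i\<in>{1..n}. t \<le> \<bar>x i\<bar>}"
    using n by simp
  ultimately show ?thesis by blast
qed

lemma mem_translate_Tower:
  assumes n: "n \<ge> 1" and x: "x \<in> rspace {1..n}" and v: "v \<in> rspace {1..n}"
    and "\<not> tower_far \<alpha> n 1 x v"
  shows "x \<in> translate_by {1..n} v (Tower \<alpha> n)"
proof -
  let ?d = "\<lambda>i\<in>{1..n}. x i - v i"
  have "{i\<in>{1..n}. t \<le> \<bar>?d i\<bar>} = {i\<in>{1..n}. 1 * t \<le> \<bar>x i - v i\<bar>}" for t by auto
  then have "\<not> (\<exists>t\<ge>1. real n * exp (\<alpha> - \<alpha> powr t) < card {i\<in>{1..n}. t \<le> \<bar>?d i\<bar>})"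
    using assms(4) by (simp only: tower_far_def not_False_eq_True simp_thms)
  then have "tower_norm \<alpha> n ?d \<le> 1"
    using tower_far_of_tower_norm[OF n, of \<alpha> ?d] by (meson not_le_imp_less)
  moreover have "?d \<in> rspace {1..n}" by (auto simp: rspace_def)
  moreover have "Tower \<alpha> n \<subseteq> rspace {1..n}" by (auto simp: Tower_def)
  ultimately show ?thesis
    using x v by (subst translate_by_eq) (auto simp: Tower_def)
qed

lemma sum_card_filter_swap:
  assumes "finite A" "finite B"
  shows "(\<Sum>f\<in>A. card {i\<in>B. R f i}) = (\<Sum>i\<in>B. card {f\<in>A. R f i})"
proof -
  have "(\<Sum>f\<in>A. card {i\<in>B. R f i}) = (\<Sum>f\<in>A. \<Sum>i\<in>B. if R f i then 1 else 0)"
    using assms by (simp add: sum.inter_filter[symmetric])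
  also have "\<dots> = (\<Sum>i\<in>B. \<Sum>f\<in>A. if R f i then 1 else 0)" by (rule sum.swap)
  also have "\<dots> = (\<Sum>i\<in>B. card {f\<in>A. R f i})"
    using assms by (simp add: sum.inter_filter[symmetric])
  finally show ?thesis .
qed

text \<open>
  The ratio of the tail bound \<open>exp (- (\<alpha> ^ (m + 2)))\<close> to the threshold \<open>exp (\<alpha> - \<alpha> ^ (m + 1))\<close> in Markov's
  inequality is summable over \<open>m \<ge> 1\<close>, with a sum of at most \<open>1/4\<close> even after multiplication by \<open>4\<close>.
  This needs a tail at \<open>m + 2\<close>, beyond the \<open>m + 1\<close> in the threshold, which the dilation pays for.
\<close>
lemma tower_ratio_bound:
  fixes \<alpha> :: real
  assumes \<alpha>: "\<alpha> \<ge> 2"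
  shows "4 * exp (- (\<alpha> ^ (m + 2))) \<le> (1/2) ^ (m + 2) * exp (\<alpha> - \<alpha> ^ (m + 1))"
proof -
  have "2 * \<alpha> ^ (m + 1) \<le> \<alpha> ^ (m + 2)" using \<alpha> by (simp add: mult_right_mono)
  moreover have "(2::real) ^ (m + 1) \<le> \<alpha> ^ (m + 1)" using \<alpha> by (intro power_mono) auto
  moreover have "real (m + 2) \<le> 2 ^ (m + 1)"
    by (induction m) auto
  ultimately have "- (\<alpha> ^ (m + 2)) \<le> - real (m + 4) + (\<alpha> - \<alpha> ^ (m + 1))"
    using \<alpha> unfolding of_nat_add of_nat_numeral by linarith
  then have "exp (- (\<alpha> ^ (m + 2))) \<le> exp (- real (m + 4)) * exp (\<alpha> - \<alpha> ^ (m + 1))"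
    unfolding exp_add[symmetric] by simp
  moreover have "exp (- real (m + 4)) \<le> (1/2) ^ (m + 4)"
  proof -
    have "exp (- 1 :: real) \<le> 1/2"
      using exp_ge_add_one_self[of "1::real"] by (simp add: exp_minus field_simps)
    then have "exp (-1 :: real) ^ (m + 4) \<le> (1/2) ^ (m + 4)" by (intro power_mono) auto
    then show ?thesis by (simp only: exp_of_nat_mult[symmetric]) simp
  qed
  then have "exp (- real (m + 4)) * exp (\<alpha> - \<alpha> ^ (m + 1)) \<le> (1/2) ^ (m + 4) * exp (\<alpha> - \<alpha> ^ (m + 1))"
    by (intro mult_right_mono) auto
  ultimately have "exp (- (\<alpha> ^ (m + 2))) \<le> (1/2) ^ (m + 4) * exp (\<alpha> - \<alpha> ^ (m + 1))"
    by (rule order_trans)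
  moreover have "(1/2::real) ^ (m + 4) = (1/2) ^ (m + 2) / 4"
    by (simp add: power_add power_divide)
  ultimately show ?thesis by simp
qed

text \<open>
  Each \<open>f\<close> is compared with the vector \<open>M\<close> of centres. If \<open>f\<close> and \<open>g\<close> are far apart, witnessed by \<open>t\<close> with
  integer part \<open>m\<close>, then one of them deviates from \<open>M\<close> by \<open>5 m\<close> in at least \<open>w m / 2\<close> coordinates, that is,
  it belongs to \<open>bad m\<close>. Averaging the number of such coordinates over \<open>A\<close>, Markov's inequality bounds
  the size of \<open>bad m\<close>; in total at most a quarter of \<open>A\<close> is bad. Since \<open>A\<close> has at least two points,
  more than one of them remains.
\<close>
lemma exists_not_tower_far:
  assumes \<alpha>: "\<alpha> \<ge> 2" and A: "finite A" "card A \<ge> 2" and n: "n \<ge> 1"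
    and tails: "\<And>i. i \<in> {1..n} \<Longrightarrow> \<exists>M. \<forall>k\<ge>1. card {f\<in>A. real k + 2 \<le> \<bar>f i - M\<bar>} \<le> 2 * card A * exp (- (\<alpha> ^ k))"
  shows "\<exists>f\<in>A. \<exists>g\<in>A. f \<noteq> g \<and> \<not> tower_far \<alpha> n 10 f g"
proof -
  have "\<forall>i\<in>{1..n}. \<exists>M. \<forall>k\<ge>1. card {f\<in>A. real k + 2 \<le> \<bar>f i - M\<bar>} \<le> 2 * card A * exp (- (\<alpha> ^ k))"
    using tails by (intro ballI)
  from bchoice[OF this] obtain M where M: "\<And>i k. i \<in> {1..n} \<Longrightarrow> k \<ge> 1 \<Longrightarrow>
      card {f\<in>A. real k + 2 \<le> \<bar>f i - M i\<bar>} \<le> 2 * card A * exp (- (\<alpha> ^ k))"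
    by blast
  define D where "D m f = card {i\<in>{1..n}. 5 * real m \<le> \<bar>f i - M i\<bar>}" for m :: nat and f :: "nat \<Rightarrow> real"
  \<comment> \<open>A lower bound for the thresholds in \<open>tower_far\<close> over all \<open>t\<close> with integer part \<open>m\<close>.\<close>
  define w where "w m = real n * exp (\<alpha> - \<alpha> ^ (m + 1))" for m :: nat
  define bad where "bad m = {f\<in>A. w m \<le> 2 * real (D m f)}" for m
  have w: "w m > 0" for m using n by (simp add: w_def)
  have bad_card: "card (bad m) \<le> card A * (1/2) ^ (m + 2)" if "m \<ge> 1" for m
  proof -
    have "card {f\<in>A. 5 * real m \<le> \<bar>f i - M i\<bar>} \<le> 2 * card A * exp (- (\<alpha> ^ (m + 2)))"
      if "i \<in> {1..n}" for i
    proof -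
      \<comment> \<open>Here the factor \<open>10 = 2 * 5\<close> is used: \<open>(m + 2) + 2 \<le> 5 m\<close> for \<open>m \<ge> 1\<close>.\<close>
      have "card {f\<in>A. 5 * real m \<le> \<bar>f i - M i\<bar>} \<le> card {f\<in>A. real (m + 2) + 2 \<le> \<bar>f i - M i\<bar>}"
        using A \<open>m \<ge> 1\<close> by (intro card_mono) auto
      then show ?thesis using M[OF that, of "m + 2"] by linarith
    qed
    then have "(\<Sum>i\<in>{1..n}. real (card {f\<in>A. 5 * real m \<le> \<bar>f i - M i\<bar>}))
        \<le> (\<Sum>i\<in>{1..n}. 2 * card A * exp (- (\<alpha> ^ (m + 2))))" by (intro sum_mono) auto
    then have total: "(\<Sum>f\<in>A. real (D m f)) \<le> n * (2 * card A * exp (- (\<alpha> ^ (m + 2))))"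
      using sum_card_filter_swap[OF A(1), of "{1..n}" "\<lambda>f i. 5 * real m \<le> \<bar>f i - M i\<bar>"]
      unfolding D_def of_nat_sum[symmetric] by simp
    have "card (bad m) * w m = (\<Sum>f\<in>bad m. w m)" by simp
    also have "\<dots> \<le> (\<Sum>f\<in>bad m. 2 * real (D m f))" by (intro sum_mono) (auto simp: bad_def)
    also have "\<dots> \<le> (\<Sum>f\<in>A. 2 * real (D m f))"
      using A by (intro sum_mono2) (auto simp: bad_def)
    also have "\<dots> = 2 * (\<Sum>f\<in>A. real (D m f))" by (simp add: sum_distrib_left)
    also have "\<dots> \<le> 2 * (n * (2 * card A * exp (- (\<alpha> ^ (m + 2)))))" using total by linarith
    also have "\<dots> = (real n * card A) * (4 * exp (- (\<alpha> ^ (m + 2))))" by simp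
    also have "\<dots> \<le> (real n * card A) * ((1/2) ^ (m + 2) * exp (\<alpha> - \<alpha> ^ (m + 1)))"
      using tower_ratio_bound[OF \<alpha>] by (intro mult_left_mono) auto
    also have "\<dots> = (card A * (1/2) ^ (m + 2)) * w m" unfolding w_def by (simp only: mult_ac)
    finally show ?thesis using w by simp
  qed
  define Bad where "Bad = (\<Union>m\<in>{1..}. bad m)"
  have Bad_sub: "Bad \<subseteq> A" by (auto simp: Bad_def bad_def)
  have "\<exists>L. Bad \<subseteq> (\<Union>m\<in>{1..L}. bad m)"
  proof -
    have "\<forall>f\<in>Bad. \<exists>m. m \<ge> 1 \<and> f \<in> bad m" by (auto simp: Bad_def)
    from bchoice[OF this] obtain h where h: "\<And>f. f \<in> Bad \<Longrightarrow> h f \<ge> 1 \<and> f \<in> bad (h f)" by blast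
    have "finite (h ` Bad)" using Bad_sub A finite_subset by blast
    then have "h f \<le> Max (h ` Bad)" if "f \<in> Bad" for f using that by simp
    then have "Bad \<subseteq> (\<Union>m\<in>{1..Max (h ` Bad)}. bad m)" using h by fastforce
    then show ?thesis by blast
  qed
  then obtain L where L: "Bad \<subseteq> (\<Union>m\<in>{1..L}. bad m)" by blast
  have "card Bad \<le> card (\<Union>m\<in>{1..L}. bad m)"
    using L A by (intro card_mono) (auto simp: bad_def)
  also have "\<dots> \<le> (\<Sum>m\<in>{1..L}. card (bad m))" by (rule card_UN_le) simp
  finally have "real (card Bad) \<le> (\<Sum>m\<in>{1..L}. real (card (bad m)))"
    unfolding of_nat_sum[symmetric] of_nat_le_iff .
  also have "\<dots> \<le> (\<Sum>m\<in>{1..L}. card A * (1/2) ^ (m + 2))" by (intro sum_mono bad_card) auto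
  also have "\<dots> = card A * (\<Sum>m\<in>{1..L}. (1/2) ^ (m + 2))" by (simp only: sum_distrib_left)
  also have "(\<Sum>m\<in>{1..L}. (1/2::real) ^ (m + 2)) = 1/4 - (1/2) ^ (L + 2)"
    by (induction L) (auto simp: power_add)
  also have "card A * (1/4 - (1/2) ^ (L + 2)) \<le> card A * (1/4 :: real)" by (intro mult_left_mono) auto
  finally have "real (card Bad) \<le> card A / 4" by simp
  moreover have "card (A - Bad) = card A - card Bad"
    using Bad_sub A by (intro card_Diff_subset) (auto intro: finite_subset)
  ultimately have "card (A - Bad) > Suc 0" using A(2) by linarith
  then obtain f g where fg: "f \<in> A - Bad" "g \<in> A - Bad" "f \<noteq> g"
    using A card_le_Suc0_iff_eq[of "A - Bad"] by (metis finite_Diff not_le)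
  have "\<not> tower_far \<alpha> n 10 f g"
  proof
    assume "tower_far \<alpha> n 10 f g"
    then obtain t where t: "t \<ge> 1"
      "real n * exp (\<alpha> - \<alpha> powr t) < card {i\<in>{1..n}. 10 * t \<le> \<bar>f i - g i\<bar>}"
      by (auto simp: tower_far_def)
    define m where "m = nat \<lfloor>t\<rfloor>"
    have m: "m \<ge> 1" "real m \<le> t" "t \<le> real (m + 1)"
      using t(1) unfolding m_def by linarith+
    have "\<alpha> powr t \<le> \<alpha> powr real (m + 1)" using \<alpha> m(3) by (intro powr_mono) auto
    also have "\<dots> = \<alpha> ^ (m + 1)" using \<alpha> by (subst powr_realpow) auto
    finally have "w m \<le> real n * exp (\<alpha> - \<alpha> powr t)"
      unfolding w_def by (intro mult_left_mono) auto
    moreover have "card {i\<in>{1..n}. 10 * t \<le> \<bar>f i - g i\<bar>} \<le>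
        card ({i\<in>{1..n}. 5 * real m \<le> \<bar>f i - M i\<bar>} \<union> {i\<in>{1..n}. 5 * real m \<le> \<bar>g i - M i\<bar>})"
      using m(2) by (intro card_mono) (auto simp: abs_if split: if_splits)
    then have "card {i\<in>{1..n}. 10 * t \<le> \<bar>f i - g i\<bar>} \<le> D m f + D m g"
      unfolding D_def using card_Un_le order_trans by blast
    moreover have "f \<notin> bad m" "g \<notin> bad m" using fg m(1) by (auto simp: Bad_def)
    then have "2 * real (D m f) < w m" "2 * real (D m g) < w m" using fg by (auto simp: bad_def)
    ultimately show False using t(2) by linarith
  qed
  then show ?thesis using fg by blast
qed

section \<open>Counting separated points by cells\<close>

text \<open>
  A set without a good split in any coordinate would have tower tails around a centre in all of
  them, which contradicts the separation. So some slab splits \<open>A\<close> well, and the bounds for the two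
  parts add up by superadditivity. A single point has the one cell of dimension zero.
\<close>
lemma card_le_hull_cells_of_tower_far:
  assumes \<alpha>: "\<alpha> \<ge> 2" and n: "n \<ge> 1"
  shows "finite A \<Longrightarrow> A \<noteq> {} \<Longrightarrow> (\<And>f g. f \<in> A \<Longrightarrow> g \<in> A \<Longrightarrow> f \<noteq> g \<Longrightarrow> tower_far \<alpha> n 10 f g)
    \<Longrightarrow> finite (hull_cells n A) \<Longrightarrow> card A powr (1/\<alpha>) \<le> card (hull_cells n A)"
proof (induction "card A" arbitrary: A rule: less_induct)
  case less
  show ?case
  proof (cases "card A \<ge> 2")
    case False
    have "card A > 0" using less.prems by (simp add: card_gt_0_iff)
    then have "card A = 1" using False by linarith
    moreover have "({}, {\<lambda>_. undefined}) \<in> hull_cells n A"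
      using hull_cells_empty_dim[OF less.prems(2)] by (auto simp: hull_cells_def)
    then have "card (hull_cells n A) > 0" using less.prems(4) card_gt_0_iff by blast
    ultimately show ?thesis by simp
  next
    case True
    have "\<exists>i\<in>{1..n}. \<not> unsplit \<alpha> A (\<lambda>f. f i)"
    proof (rule ccontr)
      assume "\<not> ?thesis"
      then have "\<exists>M. \<forall>k\<ge>1. card {f\<in>A. real k + 2 \<le> \<bar>f i - M\<bar>} \<le> 2 * card A * exp (- (\<alpha> ^ k))"
        if "i \<in> {1..n}" for i
        using tower_tail_unsplit[OF \<alpha> less.prems(1,2), of "\<lambda>f. f i"] that by blast
      then have "\<exists>f\<in>A. \<exists>g\<in>A. f \<noteq> g \<and> \<not> tower_far \<alpha> n 10 f g"
        by (rule exists_not_tower_far[OF \<alpha> less.prems(1) True n])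
      then show False using less.prems(3) by blast
    qed
    then obtain i a where i: "i \<in> {1..n}" and a: "a \<in> \<int>"
      and ne: "{f\<in>A. f i \<le> a} \<noteq> {}" "{f\<in>A. a + 1 \<le> f i} \<noteq> {}"
      and big: "card A powr (1/\<alpha>) \<le> card {f\<in>A. f i \<le> a} powr (1/\<alpha>) + card {f\<in>A. a + 1 \<le> f i} powr (1/\<alpha>)"
      unfolding unsplit_def not_less[symmetric] by blast
    let ?L = "{f\<in>A. f i \<le> a}" and ?U = "{f\<in>A. a + 1 \<le> f i}"
    have "?L \<subset> A" "?U \<subset> A" using ne by force+
    then have small: "card ?L < card A" "card ?U < card A"
      using less.prems(1) by (auto intro!: psubset_card_mono)
    have fin: "finite (hull_cells n X)" "card (hull_cells n X) \<le> card (hull_cells n A)" if "X \<subseteq> A" for X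
      using hull_cells_mono[OF that] less.prems(4) by (auto intro: finite_subset card_mono)
    have "card ?L powr (1/\<alpha>) \<le> card (hull_cells n ?L)"
      by (rule less.hyps[OF small(1) _ ne(1)]) (use less.prems fin in auto)
    moreover have "card ?U powr (1/\<alpha>) \<le> card (hull_cells n ?U)"
      by (rule less.hyps[OF small(2) _ ne(2)]) (use less.prems fin in auto)
    moreover have "card (hull_cells n ?L) + card (hull_cells n ?U) \<le> card (hull_cells n (?L \<union> ?U))"
      using fin(1)[of "?L \<union> ?U"] by (intro card_hull_cells_superadditive[OF _ _ a i]) auto
    moreover have "card (hull_cells n (?L \<union> ?U)) \<le> card (hull_cells n A)" by (rule fin(2)) auto
    ultimately show ?thesis using big by linarith
  qed
qed

lemma card_tower_far_le_cell_content:
  assumes \<alpha>: "\<alpha> \<ge> 2" and n: "n \<ge> 1" and S: "finite S" "S \<subseteq> rspace {1..n}"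
    and far: "\<And>f g. f \<in> S \<Longrightarrow> g \<in> S \<Longrightarrow> f \<noteq> g \<Longrightarrow> tower_far \<alpha> n 1 f g"
    and fin: "finite (hull_cells n (dilate {1..n} 10 S))"
  shows "card S \<le> card (hull_cells n (dilate {1..n} 10 S)) powr \<alpha>"
proof (cases "S = {}")
  case False
  let ?d = "\<lambda>x. \<lambda>i\<in>{1..n}. 10 * (x i :: real)"
  let ?A = "dilate {1..n} 10 S"
  have "inj_on ?d S"
  proof (rule inj_onI)
    fix x y assume xy: "x \<in> S" "y \<in> S" "?d x = ?d y"
    have "x i = y i" if "i \<in> {1..n}" for i using fun_cong[OF xy(3), of i] that by simp
    moreover have "x \<in> extensional {1..n}" "y \<in> extensional {1..n}"
      using xy S(2) by (auto simp: rspace_def PiE_def)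
    ultimately show "x = y" by (intro extensionalityI[of _ "{1..n}"]) auto
  qed
  then have card: "card ?A = card S" by (simp add: dilate_def card_image)
  have "tower_far \<alpha> n 10 (?d f) (?d g) \<longleftrightarrow> tower_far \<alpha> n 1 f g" for f g
  proof -
    have "{i\<in>{1..n}. 10 * t \<le> \<bar>?d f i - ?d g i\<bar>} = {i\<in>{1..n}. 1 * t \<le> \<bar>f i - g i\<bar>}" for t
      by (auto simp: abs_if split: if_splits)
    then show ?thesis unfolding tower_far_def by metis
  qed
  then have "tower_far \<alpha> n 10 f g" if "f \<in> ?A" "g \<in> ?A" "f \<noteq> g" for f g
    using that far unfolding dilate_def by blast
  then have "card ?A powr (1/\<alpha>) \<le> card (hull_cells n ?A)"
    using S False fin by (intro card_le_hull_cells_of_tower_far[OF \<alpha> n]) (auto simp: dilate_def)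
  then have "(card ?A powr (1/\<alpha>)) powr \<alpha> \<le> card (hull_cells n ?A) powr \<alpha>"
    using \<alpha> by (intro powr_mono2) auto
  then show ?thesis unfolding card using \<alpha> by (simp add: powr_powr)
qed simp

text \<open>
  The bound on the sizes of separated sets provides one of maximal size. No point of \<open>F\<close> can be
  added to it, so every point of \<open>F\<close> lies in the translate of the tower by some element of it.
\<close>
lemma covering_number_Tower_le:
  fixes K :: real
  assumes n: "n \<ge> 1" and F: "F \<subseteq> rspace {1..n}"
    and bound: "\<And>S. finite S \<Longrightarrow> S \<subseteq> F \<Longrightarrow>
      (\<And>f g. f \<in> S \<Longrightarrow> g \<in> S \<Longrightarrow> f \<noteq> g \<Longrightarrow> tower_far \<alpha> n 1 f g) \<Longrightarrow> card S \<le> K"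
  shows "ereal_of_enat (covering_number {1..n} F (Tower \<alpha> n)) \<le> ereal K"
proof -
  define sep where "sep S \<longleftrightarrow> finite S \<and> S \<subseteq> F \<and> (\<forall>f\<in>S. \<forall>g\<in>S. f \<noteq> g \<longrightarrow> tower_far \<alpha> n 1 f g)" for S
  have le: "card S \<le> K" if "sep S" for S using that bound by (auto simp: sep_def)
  have "sep {}" by (simp add: sep_def)
  moreover have "card S \<le> nat \<lfloor>K\<rfloor>" if "sep S" for S
    using le[OF that] by (simp add: le_nat_floor)
  ultimately obtain S where S: "sep S" "\<And>S'. sep S' \<Longrightarrow> card S' \<le> card S"
    using ex_has_greatest_nat[of sep "{}" card "Suc (nat \<lfloor>K\<rfloor>)"] by (auto simp: less_Suc_eq_le)
  let ?T = "(\<lambda>v. translate_by {1..n} v (Tower \<alpha> n)) ` S"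
  have "F \<subseteq> \<Union>?T"
  proof
    fix x assume x: "x \<in> F"
    have sym: "tower_far \<alpha> n 1 f g \<longleftrightarrow> tower_far \<alpha> n 1 g f" for f g
      by (simp add: tower_far_def abs_minus_commute)
    have "\<exists>v\<in>S. \<not> tower_far \<alpha> n 1 x v"
    proof (rule ccontr)
      assume *: "\<not> ?thesis"
      have "\<not> tower_far \<alpha> n 1 x x" by (auto simp: tower_far_def not_less)
      with * have "x \<notin> S" by blast
      have "sep (insert x S)" using * S(1) x sym unfolding sep_def by blast
      from S(2)[OF this] \<open>x \<notin> S\<close> S(1) show False by (simp add: sep_def)
    qed
    then obtain v where v: "v \<in> S" "\<not> tower_far \<alpha> n 1 x v" by blast
    have "v \<in> F" using v S(1) by (auto simp: sep_def)
    then have "x \<in> translate_by {1..n} v (Tower \<alpha> n)"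
      using x v(2) F by (intro mem_translate_Tower[OF n]) auto
    then show "x \<in> \<Union>?T" using v(1) by blast
  qed
  moreover have "?T \<subseteq> (\<lambda>v. translate_by {1..n} v (Tower \<alpha> n)) ` rspace {1..n}"
    using S(1) F by (auto simp: sep_def)
  ultimately have "covering_number {1..n} F (Tower \<alpha> n) \<le> ecard ?T"
    unfolding covering_number_def by (intro INF_lower) auto
  also have "\<dots> \<le> enat (card S)"
    using S(1) by (simp add: sep_def ecard_def card_image_le)
  finally have "ereal_of_enat (covering_number {1..n} F (Tower \<alpha> n)) \<le> ereal_of_enat (enat (card S))"
    by (simp only: ereal_of_enat_le_iff)
  also have "\<dots> \<le> ereal K" using le[OF S(1)] by simp
  finally show ?thesis .
qed

theorem theorem3p1:
  shows "\<exists>C::real. C > 0 \<and>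
    (\<forall>(n::nat) (F::(nat \<Rightarrow> real) set) (\<alpha>::real).
       n \<ge> 1 \<longrightarrow> F \<subseteq> rspace {1..n} \<longrightarrow> F \<noteq> {} \<longrightarrow> \<alpha> \<ge> 2 \<longrightarrow>
       ereal_of_enat (covering_number {1..n} F (Tower \<alpha> n))
         \<le> enat_powr (cell_content n (dilate {1..n} C F)) \<alpha>)"
proof (intro exI[of _ 10] conjI allI impI)
  fix n :: nat and F :: "(nat \<Rightarrow> real) set" and \<alpha> :: real
  assume n: "n \<ge> 1" and F: "F \<subseteq> rspace {1..n}" "F \<noteq> {}" and \<alpha>: "\<alpha> \<ge> 2"
  let ?H = "\<lambda>S. hull_cells n (dilate {1..n} 10 S)"
  have content: "cell_content n (dilate {1..n} 10 F) = ecard (?H F)"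
    using F(2) by (intro cell_content_eq_ecard) (simp add: dilate_def)
  show "ereal_of_enat (covering_number {1..n} F (Tower \<alpha> n))
      \<le> enat_powr (cell_content n (dilate {1..n} 10 F)) \<alpha>"
  proof (cases "finite (?H F)")
    case True
    have "ereal_of_enat (covering_number {1..n} F (Tower \<alpha> n)) \<le> ereal (card (?H F) powr \<alpha>)"
    proof (rule covering_number_Tower_le[OF n F(1)])
      fix S assume S: "finite S" "S \<subseteq> F"
        "\<And>f g. f \<in> S \<Longrightarrow> g \<in> S \<Longrightarrow> f \<noteq> g \<Longrightarrow> tower_far \<alpha> n 1 f g"
      have sub: "?H S \<subseteq> ?H F" using S(2) by (intro hull_cells_mono) (auto simp: dilate_def)
      have "card S \<le> card (?H S) powr \<alpha>"
        using S F finite_subset[OF sub True] by (intro card_tower_far_le_cell_content[OF \<alpha> n]) auto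
      also have "\<dots> \<le> card (?H F) powr \<alpha>"
        using card_mono[OF True sub] \<alpha> by (intro powr_mono2) auto
      finally show "card S \<le> card (?H F) powr \<alpha>" .
    qed
    then show ?thesis using True unfolding content by (simp add: ecard_def enat_powr_def)
  next
    case False
    then show ?thesis unfolding content by (simp add: ecard_def enat_powr_def)
  qed
qed simp

end
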